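(* The distance-$3$ commuting set of pairs of $4\times 4$ real matrices, $\mathcal{C}_4^3(\mathbb{R})=\{(A,B)\in\mathrm{Mat}_{4\times 4}(\mathbb{R})^2\mid d_{\mathbb{R}}(A,B)\leq 3\}$, is not an affine variety in $\mathrm{Mat}_{4\times 4}(\mathbb{R})^2=\mathbb{R}^{32}$.
   Context: A matrix is scalar if it is a constant multiple of the identity. The commuting graph $\Gamma(\mathrm{Mat}_{4\times 4}(\mathbb{R}))$ has as vertices the non-scalar real $4\times 4$ matrices, with an edge between distinct $A$ and $B$ if and only if $AB=BA$. For non-scalar $A,B$, the commuting distance $d_{\mathbb{R}}(A,B)$ is the graph distance between $A$ and $B$ in this graph (equal to $\infty$ if they lie in different connected components). It is extended to all matrices by $d_{\mathbb{R}}(A,A)=0$ and $d_{\mathbb{R}}(A,B)=d_{\mathbb{R}}(B,A)=1$ whenever $A$ is scalar and $A\neq B$. An affine variety in $\mathbb{R}^N$ is the common zero set in $\mathbb{R}^N$ of finitely many polynomials with real coefficients. *)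

theory Defs
  imports "HOL-Analysis.Analysis" "HOL-Library.Extended_Nat"
begin

definition scalar_matrix :: "real^'n^'n \<Rightarrow> bool" where
  "scalar_matrix A \<longleftrightarrow> (\<exists>c. A = mat c)"

definition commuting_graph_verts :: "(real^'n^'n) set" where
  "commuting_graph_verts = {A. \<not> scalar_matrix A}"

definition commuting_graph_edges :: "((real^'n^'n) \<times> (real^'n^'n)) set" where
  "commuting_graph_edges =
     {(A, B). A \<in> commuting_graph_verts \<and> B \<in> commuting_graph_verts \<and> A \<noteq> B \<and> A ** B = B ** A}"

text \<open>Graph distance for an edge relation \<open>E\<close>: \<open>E ^^ k\<close> relates the endpoints of the walks with
  \<open>k\<close> edges, and the infimum of the empty set of lengths is \<open>\<infinity>\<close>.\<close>

definition graph_dist :: "('a \<times> 'a) set \<Rightarrow> 'a \<Rightarrow> 'a \<Rightarrow> enat" where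
  "graph_dist E x y = (INF k\<in>{k. (x, y) \<in> E ^^ k}. enat k)"

definition commuting_dist :: "real^'n^'n \<Rightarrow> real^'n^'n \<Rightarrow> enat" where
  "commuting_dist A B =
     (if A = B then 0
      else if scalar_matrix A \<or> scalar_matrix B then 1
      else graph_dist commuting_graph_edges A B)"

definition commuting_set :: "nat \<Rightarrow> ((real^'n^'n) \<times> (real^'n^'n)) set" where
  "commuting_set d = {(A, B). commuting_dist A B \<le> enat d}"

text \<open>On a Euclidean space every linear functional is bounded, so \<^const>\<open>real_polynomial_function\<close>
  describes exactly the functions given by real polynomials in the coordinates.\<close>

definition affine_variety :: "'a::euclidean_space set \<Rightarrow> bool" where
  "affine_variety S \<longleftrightarrow>
     (\<exists>P. finite P \<and> (\<forall>p\<in>P. real_polynomial_function p) \<and> S = {x. \<forall>p\<in>P. p x = 0})"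

end

theory Submission
  imports Defs
begin

text \<open>The pairs \<open>(A\<^sub>t, B\<^sub>t)\<close> below form a line in the space of pairs of matrices. Both \<open>A\<^sub>t\<close> and
  \<open>B\<^sub>t\<close> have the eigenvalue \<open>\<surd>t\<close>, and the two associated rank-one spectral projections annihilate
  each other. For \<open>t > 0\<close> these projections are real, which gives a path of length 3 from \<open>A\<^sub>t\<close> to
  \<open>B\<^sub>t\<close>, so every polynomial vanishing on the distance-3 set vanishes on the whole line. For
  \<open>t = -1\<close> the projections are complex. Modulo scalars the centralizers of \<open>A\<^sub>t\<close> and \<open>B\<^sub>t\<close> are
  then 3-dimensional, and the projections and their complex conjugates are the only source of
  commuting elements: a real commuting pair leads to \<open>(x\<^sup>2 + y\<^sup>2) (u\<^sup>2 + v\<^sup>2) = 0\<close>, whence one of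
  the two matrices is scalar.\<close>

definition mat4 :: "real \<Rightarrow> real \<Rightarrow> real \<Rightarrow> real \<Rightarrow> real \<Rightarrow> real \<Rightarrow> real \<Rightarrow> real \<Rightarrow>
    real \<Rightarrow> real \<Rightarrow> real \<Rightarrow> real \<Rightarrow> real \<Rightarrow> real \<Rightarrow> real \<Rightarrow> real \<Rightarrow> real^4^4" where
  "mat4 a b c d e f g h i j k l m n p q =
     vector [vector [a, b, c, d], vector [e, f, g, h], vector [i, j, k, l], vector [m, n, p, q]]"

lemma vector_4:
  "(vector [a, b, c, d] :: ('a::zero)^4) $ 1 = a"
  "(vector [a, b, c, d] :: ('a::zero)^4) $ 2 = b"
  "(vector [a, b, c, d] :: ('a::zero)^4) $ 3 = c"
  "(vector [a, b, c, d] :: ('a::zero)^4) $ 4 = d"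
  unfolding vector_def by simp_all

lemmas mat4_simps = mat4_def vector_4 vec_eq_iff forall_4 sum_4 matrix_matrix_mult_def

lemma scalar_matrix_4_iff:
  fixes X :: "real^4^4"
  shows "scalar_matrix X \<longleftrightarrow>
    X$1$2 = 0 \<and> X$1$3 = 0 \<and> X$1$4 = 0 \<and> X$2$1 = 0 \<and> X$2$3 = 0 \<and> X$2$4 = 0 \<and>
    X$3$1 = 0 \<and> X$3$2 = 0 \<and> X$3$4 = 0 \<and> X$4$1 = 0 \<and> X$4$2 = 0 \<and> X$4$3 = 0 \<and>
    X$2$2 = X$1$1 \<and> X$3$3 = X$1$1 \<and> X$4$4 = X$1$1"
  unfolding scalar_matrix_def by (auto simp: vec_eq_iff forall_4 mat_def)

text \<open>\<open>enat\<close> is well-ordered, so the infimum over a nonempty set of walk lengths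
  is attained; over the empty set it is infinite.\<close>

lemma graph_dist_le_iff: "graph_dist E x y \<le> enat n \<longleftrightarrow> (\<exists>k\<le>n. (x, y) \<in> E ^^ k)"
proof
  assume le: "graph_dist E x y \<le> enat n"
  let ?S = "enat ` {k. (x, y) \<in> E ^^ k}"
  have "?S \<noteq> {}"
  proof
    assume "?S = {}"
    then have "graph_dist E x y = \<infinity>"
      unfolding graph_dist_def by (simp only: Inf_empty top_enat_def)
    with le show False by simp
  qed
  then have "Inf ?S \<in> ?S"
    by (metis ex_in_conv wellorder_InfI)
  with le show "\<exists>k\<le>n. (x, y) \<in> E ^^ k"
    by (auto simp: graph_dist_def)
next
  assume "\<exists>k\<le>n. (x, y) \<in> E ^^ k"
  then show "graph_dist E x y \<le> enat n"
    unfolding graph_dist_def by (meson INF_lower2 enat_ord_simps(1) mem_Collect_eq)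
qed

text \<open>Every matrix commutes with itself, so a walk with fewer than 3 edges can be padded by
  loops. Conversely, deleting the loops leaves a walk with at most 3 edges.\<close>

lemma commuting_set_3_nonscalar_iff:
  fixes A B :: "real^'n^'n"
  assumes "\<not> scalar_matrix A" "\<not> scalar_matrix B"
  shows "(A, B) \<in> commuting_set 3 \<longleftrightarrow>
    (\<exists>X Y. \<not> scalar_matrix X \<and> \<not> scalar_matrix Y \<and> A ** X = X ** A \<and> X ** Y = Y ** X \<and> Y ** B = B ** Y)"
    (is "_ \<longleftrightarrow> ?path")
proof -
  let ?E = "commuting_graph_edges :: ((real^'n^'n) \<times> (real^'n^'n)) set"
  let ?R = "{(A, B). \<not> scalar_matrix A \<and> \<not> scalar_matrix B \<and> A ** B = B ** A} :: ((real^'n^'n) \<times> (real^'n^'n)) set"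
  have E: "?E \<subseteq> ?R" "\<And>X Y. (X, Y) \<in> ?R \<Longrightarrow> X = Y \<or> (X, Y) \<in> ?E"
    by (auto simp: commuting_graph_edges_def commuting_graph_verts_def)
  have dist: "(A, B) \<in> commuting_set 3 \<longleftrightarrow> (\<exists>k\<le>3. (A, B) \<in> ?E ^^ k)"
    using assms by (auto simp: commuting_set_def commuting_dist_def graph_dist_le_iff zero_enat_def[symmetric]
        intro!: exI[of _ 0])
  have le3: "k = 0 \<or> k = 1 \<or> k = 2 \<or> k = 3" if "k \<le> 3" for k :: nat
    using that by linarith
  show ?thesis
  proof
    assume "(A, B) \<in> commuting_set 3"
    then obtain k where k: "k \<le> 3" "(A, B) \<in> ?E ^^ k"
      using dist by blast
    have refl: "(A, A) \<in> ?R" "(B, B) \<in> ?R"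
      using assms by auto
    consider "A = B" | "(A, B) \<in> ?E" | X where "(A, X) \<in> ?E" "(X, B) \<in> ?E"
      | X Y where "(A, X) \<in> ?E" "(X, Y) \<in> ?E" "(Y, B) \<in> ?E"
      using le3[OF k(1)] k(2) by (auto simp: numeral_2_eq_2 numeral_3_eq_3)
    then have "\<exists>X Y. (A, X) \<in> ?R \<and> (X, Y) \<in> ?R \<and> (Y, B) \<in> ?R"
      using E(1) refl by cases blast+
    then show ?path by auto
  next
    assume ?path
    then obtain X Y where "(A, X) \<in> ?R" "(X, Y) \<in> ?R" "(Y, B) \<in> ?R"
      using assms by auto
    then have "(A, B) \<in> ?E ^^ 0 \<union> ?E ^^ 1 \<union> ?E ^^ 2 \<union> ?E ^^ 3"
      using E(2)[of A X] E(2)[of X Y] E(2)[of Y B]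
      by (auto simp: numeral_2_eq_2 numeral_3_eq_3)
    then show "(A, B) \<in> commuting_set 3"
      unfolding dist by (elim UnE) (rule exI, rule conjI[rotated], assumption, simp)+
  qed
qed

text \<open>On a line each defining polynomial becomes a polynomial in one variable; infinitely many
  roots make it zero.\<close>

lemma affine_variety_line:
  fixes S :: "'a::euclidean_space set"
  assumes "affine_variety S" and "infinite {t. u + t *\<^sub>R v \<in> S}"
  shows "u + t *\<^sub>R v \<in> S"
proof -
  obtain P where P: "\<And>p. p \<in> P \<Longrightarrow> real_polynomial_function p" "S = {x. \<forall>p\<in>P. p x = 0}"
    using assms(1) unfolding affine_variety_def by blast
  have "p (u + t *\<^sub>R v) = 0" if "p \<in> P" for p
  proof -
    have "polynomial_function (\<lambda>t::real. u + t *\<^sub>R v)"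
      by (intro polynomial_function_add polynomial_function_mult) auto
    then have "real_polynomial_function (p \<circ> (\<lambda>t. u + t *\<^sub>R v))"
      using P(1)[OF that] by (rule real_polynomial_function_compose)
    then obtain a n where a: "p \<circ> (\<lambda>t. u + t *\<^sub>R v) = (\<lambda>t. \<Sum>i\<le>n. a i * t ^ i)"
      unfolding real_polynomial_function_iff_sum by blast
    have "{t. u + t *\<^sub>R v \<in> S} \<subseteq> {t. (\<Sum>i\<le>n. a i * t ^ i) = 0}"
      using P(2) that fun_cong[OF a] by auto
    then have "infinite {t. (\<Sum>i\<le>n. a i * t ^ i) = 0}"
      using assms(2) infinite_super by blast
    then have "\<forall>i\<le>n. a i = 0"
      using Transcendental.polyfun_finite_roots by blast
    then show ?thesis
      using fun_cong[OF a, of t] by simp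
  qed
  then show ?thesis using P(2) by simp
qed

text \<open>In \<open>2 \<times> 2\<close> blocks, with \<open>K = [[0, t], [1, 0]]\<close> and \<open>M = diag(1, -1)\<close>, these are
  \<open>A = diag(K, E\<^sub>1\<^sub>1)\<close> and \<open>B = S diag(K, E\<^sub>1\<^sub>2) S\<^sup>-\<^sup>1\<close>, where \<open>S = [[M, I], [2M, I]]\<close>.\<close>

definition line_A :: "real \<Rightarrow> real^4^4" where
  "line_A t = mat4 0 t 0 0  1 0 0 0  0 0 1 0  0 0 0 0"

definition line_B :: "real \<Rightarrow> real^4^4" where
  "line_B t = mat4 0 (t + 2) 0 (- t - 1)  1 0 (- 1) 0  0 (2 * t + 2) 0 (- 2 * t - 1)  2 0 (- 2) 0"

lemma not_scalar_line: "\<not> scalar_matrix (line_A t)" "\<not> scalar_matrix (line_B t)"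
  by (simp_all add: scalar_matrix_4_iff line_A_def line_B_def mat4_def vector_4)

lemma line_affine:
  "(line_A t, line_B t) =
    (line_A 0, line_B 0) + t *\<^sub>R (line_A 1 - line_A 0, line_B 1 - line_B 0)"
  by (simp add: line_A_def line_B_def mat4_simps algebra_simps)

lemma line_mem_if_pos:
  assumes "t > 0"
  shows "(line_A t, line_B t) \<in> commuting_set 3"
proof -
  define s where "s = sqrt t"
  have t: "t = s * s"
    using assms by (simp add: s_def)
  \<comment> \<open>In the blocks described above, \<open>X = diag(K + s, 0)\<close>. As
    \<open>K\<close> squared is \<open>t\<close>, this is \<open>2 * s\<close> times the projection
    of \<open>line_A t\<close> for the eigenvalue \<open>s\<close>.\<close>
  define X where "X = mat4 s t 0 0  1 s 0 0  0 0 0 0  0 0 0 0"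
  \<comment> \<open>Likewise \<open>Y\<close> is the conjugate of \<open>diag(K + s, 0)\<close> by
    \<open>S\<close>. Its blocks are multiples of \<open>K - s\<close>, and
    \<open>(K + s) (K - s) = 0\<close>, so \<open>X ** Y\<close> and \<open>Y ** X\<close> both
    vanish.\<close>
  define Y where "Y = mat4 (- s) t s (- t)  1 (- s) (- 1) s
    (- 2 * s) (2 * t) (2 * s) (- 2 * t)  2 (- 2 * s) (- 2) (2 * s)"
  have "\<not> scalar_matrix X" "\<not> scalar_matrix Y"
    by (simp_all add: scalar_matrix_4_iff X_def Y_def mat4_def vector_4)
  moreover have "line_A t ** X = X ** line_A t"
    by (simp add: line_A_def X_def mat4_simps t algebra_simps)
  moreover have "X ** Y = Y ** X"
    by (simp add: X_def Y_def mat4_simps t algebra_simps)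
  moreover have "Y ** line_B t = line_B t ** Y"
    by (simp add: line_B_def Y_def mat4_simps t algebra_simps)
  ultimately show ?thesis
    using not_scalar_line by (subst commuting_set_3_nonscalar_iff) blast+
qed

text \<open>The eigenvalues i, -i, 1, 0 are distinct, so the centralizer splits into a copy of the
  complex numbers and two scalars.\<close>

lemma commute_line_A_minus_one:
  assumes "line_A (-1) ** X = X ** line_A (-1)"
  obtains a b c d where "X = mat4 a (- b) 0 0  b a 0 0  0 0 c 0  0 0 0 d"
proof
  show "X = mat4 (X$1$1) (- X$2$1) 0 0  (X$2$1) (X$1$1) 0 0  0 0 (X$3$3) 0  0 0 0 (X$4$4)"
    unfolding vec_eq_iff forall_4
    by (intro conjI; simp add: mat4_def vector_4; use assms in \<open>simp (no_asm_use) add: line_A_def mat4_simps; linarith\<close>)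
qed

text \<open>The rows \<open>e\<^sub>1 B\<^sup>k\<close> with \<open>k < 4\<close> are linearly independent, so the first row of \<open>Y\<close> determines
  the others.\<close>

lemma commute_line_B_minus_one:
  assumes "Y ** line_B (-1) = line_B (-1) ** Y"
  obtains p q r w where "Y = mat4 p q r w  (q + 2 * w) p (- q - 2 * w) r
    (- 2 * r) (- 2 * w) (p + 3 * r) (q + 3 * w)
    (2 * q + 4 * w) (- 2 * r) (- 2 * q - 4 * w) (p + 3 * r)"
proof
  let ?p = "Y$1$1" and ?q = "Y$1$2" and ?r = "Y$1$3" and ?w = "Y$1$4"
  show "Y = mat4 ?p ?q ?r ?w  (?q + 2 * ?w) ?p (- ?q - 2 * ?w) ?r
    (- 2 * ?r) (- 2 * ?w) (?p + 3 * ?r) (?q + 3 * ?w)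
    (2 * ?q + 4 * ?w) (- 2 * ?r) (- 2 * ?q - 4 * ?w) (?p + 3 * ?r)"
    unfolding vec_eq_iff forall_4
    by (intro conjI; simp add: mat4_def vector_4; use assms in \<open>simp (no_asm_use) add: line_B_def mat4_simps; linarith\<close>)
qed

lemma line_minus_one_not_mem: "(line_A (-1), line_B (-1)) \<notin> commuting_set 3"
proof
  assume "(line_A (-1), line_B (-1)) \<in> commuting_set 3"
  then obtain X Y where nonscalar: "\<not> scalar_matrix X" "\<not> scalar_matrix Y"
    and AX: "line_A (-1) ** X = X ** line_A (-1)" and XY: "X ** Y = Y ** X"
    and YB: "Y ** line_B (-1) = line_B (-1) ** Y"
    using commuting_set_3_nonscalar_iff[OF not_scalar_line] by blast
  obtain a b c d where X: "X = mat4 a (- b) 0 0  b a 0 0  0 0 c 0  0 0 0 d"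
    using commute_line_A_minus_one[OF AX] .
  obtain p q r w where Y: "Y = mat4 p q r w  (q + 2 * w) p (- q - 2 * w) r
    (- 2 * r) (- 2 * w) (p + 3 * r) (q + 3 * w)
    (2 * q + 4 * w) (- 2 * r) (- 2 * q - 4 * w) (p + 3 * r)"
    using commute_line_B_minus_one[OF YB] .
  have X_nonscalar: "\<not> (b = 0 \<and> c = a \<and> d = a)" and Y_nonscalar: "\<not> (q = 0 \<and> r = 0 \<and> w = 0)"
    using nonscalar by (auto simp: scalar_matrix_4_iff X Y mat4_def vector_4)
  have entries: "(X ** Y)$i$j = (Y ** X)$i$j" for i j
    by (simp add: XY)
  note entry_simps = X Y mat4_def vector_4 matrix_matrix_mult_def sum_4 algebra_simps
  have e11: "b * (q + w) = 0"
    using entries[of 1 1] by (simp add: entry_simps)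
  have e13: "(a - c) * r + b * (q + 2 * w) = 0"
    using entries[of 1 3] by (simp add: entry_simps)
  have e14: "(a - d) * w = b * r"
    using entries[of 1 4] by (simp add: entry_simps)
  have e23: "b * r = (a - c) * (q + 2 * w)"
    using entries[of 2 3] by (simp add: entry_simps)
  have e24: "(a - d) * r + b * w = 0"
    using entries[of 2 4] by (simp add: entry_simps)
  have e32: "(a - c) * w = b * r"
    using entries[of 3 2] by (simp add: entry_simps)
  have e43: "(c - d) * (q + 2 * w) = 0"
    using entries[of 4 3] by (simp add: entry_simps)
  \<comment> \<open>Multiplicativity of the complex norm for \<open>(a - c) + i b\<close> and the
    conjugate of \<open>r + i (q + 2 * w)\<close>: \<open>e13\<close> and \<open>e23\<close> kill
    the real and imaginary parts of their product.\<close>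
  have "((a - c)\<^sup>2 + b\<^sup>2) * (r\<^sup>2 + (q + 2 * w)\<^sup>2)
      = ((a - c) * r + b * (q + 2 * w))\<^sup>2 + (b * r - (a - c) * (q + 2 * w))\<^sup>2"
    by algebra
  also have "\<dots> = 0"
    using e13 e23 by simp
  finally consider "a = c" "b = 0" | "r = 0" "q = - 2 * w"
    by auto
  \<comment> \<open>In case 1, \<open>d \<noteq> a\<close> forces \<open>r\<close>, \<open>w\<close>
    and then \<open>q\<close> to vanish. In case 2, \<open>w \<noteq> 0\<close> forces
    \<open>b = 0\<close> and \<open>a = c = d\<close>.\<close>
  then show False
  proof cases
    case 1
    then show False
      using X_nonscalar Y_nonscalar e14 e24 e43 by auto
  next
    case 2
    then show False
      using X_nonscalar Y_nonscalar e11 e14 e32 by auto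
  qed
qed

theorem proposition1p3:
  "\<not> affine_variety (commuting_set 3 :: ((real^4^4) \<times> (real^4^4)) set)"
proof
  let ?u = "(line_A 0, line_B 0)" and ?v = "(line_A 1 - line_A 0, line_B 1 - line_B 0)"
  assume variety: "affine_variety (commuting_set 3 :: ((real^4^4) \<times> (real^4^4)) set)"
  have "{0<..} \<subseteq> {t. ?u + t *\<^sub>R ?v \<in> commuting_set 3}"
    using line_mem_if_pos by (auto simp only: line_affine[symmetric] greaterThan_iff)
  then have "infinite {t. ?u + t *\<^sub>R ?v \<in> commuting_set 3}"
    using infinite_Ioi infinite_super by blast
  then have "?u + (-1) *\<^sub>R ?v \<in> commuting_set 3"
    by (rule affine_variety_line[OF variety])
  then show False
    using line_minus_one_not_mem by (simp only: line_affine[symmetric])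
qed

end
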